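(* Let $m,n,q$ be positive integers, $M\in\mathbb{R}^{m\times n}$, $\Omega\subset\{1,\ldots,m\}\times\{1,\ldots,n\}$, $\alpha,\beta>0$ and $\gamma\in(0,1.618)$. Let $\{(W_k,\Lambda_k,\Pi_k)\}_{k\ge 0}$, with $W_k=(X_k,Y_k,Z_k,U_k,V_k)$, be a sequence generated by the ADM algorithm, i.e. satisfying for all $k\ge 0$ $$\begin{aligned} X_{k+1}&=(Z_kY_k^\top+\alpha U_k-\Lambda_k)(Y_kY_k^\top+\alpha I)^{-1},\\ Y_{k+1}&=(X_{k+1}^\top X_{k+1}+\beta I)^{-1}(X_{k+1}^\top Z_k+\beta V_k-\Pi_k),\\ Z_{k+1}&=X_{k+1}Y_{k+1}+\mathcal{P}_\Omega(M-X_{k+1}Y_{k+1}),\\ U_{k+1}&=\mathcal{P}_+(X_{k+1}+\Lambda_k/\alpha),\\ V_{k+1}&=\mathcal{P}_+(Y_{k+1}+\Pi_k/\beta),\\ \Lambda_{k+1}&=\Lambda_k+\gamma\alpha(X_{k+1}-U_{k+1}),\\ \Pi_{k+1}&=\Pi_k+\gamma\beta(Y_{k+1}-V_{k+1}). \end{aligned}$$ Suppose that the multiplier sequence $\{(\Lambda_k,\Pi_k)\}$ is bounded and satisfies $$\sum_{k=0}^\infty\left(\|\Lambda_{k+1}-\Lambda_k\|_F^2+\|\Pi_{k+1}-\Pi_k\|_F^2\right)<\infty.$$ Then any accumulation point of $\{W_k\}$ satisfies the KKT condition for the problem $$\min_{(U,V,X,Y,Z)}\ \tfrac12\|XY-Z\|_F^2\quad\text{s.t.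 } X=U,\ Y=V,\ U\ge 0,\ V\ge 0,\ \mathcal{P}_\Omega(Z-M)=0 .\qquad (\mathrm{S})$$ Consequently, any accumulation point of $\{(X_k,Y_k)\}$ satisfies the KKT condition for the problem $$\min_{X,Y}\left\{\|\mathcal{P}_\Omega(XY-M)\|_F^2:\ X\in\mathbb{R}^{m\times q},\ Y\in\mathbb{R}^{q\times n},\ X\ge 0,\ Y\ge 0\right\}.\qquad (\mathrm{N})$$
   Context: Matrix sizes: $X_k,U_k,\Lambda_k\in\mathbb{R}^{m\times q}$, $Y_k,V_k,\Pi_k\in\mathbb{R}^{q\times n}$, $Z_k\in\mathbb{R}^{m\times n}$. The sequence starts from given initial matrices, and $I$ is the $q\times q$ identity. $\mathcal{P}_\Omega(A)$ is the copy of $A$ in which the entries with index not in $\Omega$ are replaced by zero; $\Omega^c$ is the complement of $\Omega$ in $\{1,\ldots,m\}\times\{1,\ldots,n\}$, and $\mathcal{P}_{\Omega^c}$ is defined analogously. $(\mathcal{P}_+(A))_{ij}=\max\{a_{ij},0\}$. $\|\cdot\|_F$ is the Frobenius norm, $\odot$ is the component-wise product, and inequalities between matrices are component-wise. KKT condition for problem (S): a point $(X,Y,Z,U,V)$ satisfies it if there exist $\Lambda\in\mathbb{R}^{m\times q}$ and $\Pi\in\mathbb{R}^{q\times n}$ such that $$\begin{aligned} &(XY-Z)Y^\top+\Lambda=0,\quad X^\top(XY-Z)+\Pi=0,\quad \mathcal{P}_{\Omega^c}(XY-Z)=0,\quad \mathcal{P}_\Omega(Z-M)=0,\\ &X-U=0,\quad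 Y-V=0,\quad \Lambda\le 0\le U,\ \Lambda\odot U=0,\quad \Pi\le 0\le V,\ \Pi\odot V=0. \end{aligned}$$ KKT condition for problem (N): a point $(X,Y)$ satisfies it if $X\ge 0$, $Y\ge 0$, $\mathcal{P}_\Omega(XY-M)Y^\top\ge 0$, $X^\top\mathcal{P}_\Omega(XY-M)\ge 0$, $X\odot\big(\mathcal{P}_\Omega(XY-M)Y^\top\big)=0$ and $Y\odot\big(X^\top\mathcal{P}_\Omega(XY-M)\big)=0$ (the standard KKT system of (N), up to a positive factor 2 in the gradient). *)

theory Defs
  imports "HOL-Analysis.Analysis"
begin

text \<open>
  An \<open>m \<times> n\<close> real matrix is an element of \<open>real ^ 'n ^ 'm\<close>, and \<open>{1..m} \<times> {1..n}\<close> is the type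
  \<open>'m \<times> 'n\<close>; index types are nonempty. On such matrices the library's \<open>\<le>\<close> and \<open>*\<close> both act
  entry by entry, so \<open>A * B\<close> is the component-wise product; matrix multiplication is \<open>**\<close>.
\<close>

definition frob_norm :: "real ^ 'n ^ 'm \<Rightarrow> real" where
  "frob_norm A = sqrt (\<Sum>i\<in>UNIV. \<Sum>j\<in>UNIV. (A $ i $ j)\<^sup>2)"

lemma frob_norm_eq_norm: "frob_norm A = norm A"
  by (simp add: frob_norm_def norm_vec_def L2_set_def sum_nonneg)

definition proj_on :: "('m \<times> 'n) set \<Rightarrow> real ^ 'n ^ 'm \<Rightarrow> real ^ 'n ^ 'm" where
  "proj_on S A = (\<chi> i j. if (i, j) \<in> S then A $ i $ j else 0)"

definition proj_nonneg :: "real ^ 'n ^ 'm \<Rightarrow> real ^ 'n ^ 'm" where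
  "proj_nonneg A = (\<chi> i j. max (A $ i $ j) 0)"

text \<open>
  The two matrices inverted below are positive definite for \<open>\<alpha>, \<beta> > 0\<close>, so \<open>matrix_inv\<close> is
  the genuine inverse. The initial matrices (index \<open>0\<close>) are unconstrained.
  The multiplier of \<open>Y = V\<close>, usually written as a capital Pi, is called \<open>\<Psi>\<close> since Pi is taken
  by the library's dependent-product binder.
\<close>

definition adm_sequence ::
  "('m \<times> 'n) set \<Rightarrow> real ^ 'n ^ 'm \<Rightarrow> real \<Rightarrow> real \<Rightarrow> real \<Rightarrow>
   (nat \<Rightarrow> real ^ 'q ^ 'm) \<Rightarrow> (nat \<Rightarrow> real ^ 'n ^ 'q) \<Rightarrow> (nat \<Rightarrow> real ^ 'n ^ 'm) \<Rightarrow>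
   (nat \<Rightarrow> real ^ 'q ^ 'm) \<Rightarrow> (nat \<Rightarrow> real ^ 'n ^ 'q) \<Rightarrow>
   (nat \<Rightarrow> real ^ 'q ^ 'm) \<Rightarrow> (nat \<Rightarrow> real ^ 'n ^ 'q) \<Rightarrow> bool" where
  "adm_sequence \<Omega> M \<alpha> \<beta> \<gamma> X Y Z U V \<Lambda> \<Psi> \<longleftrightarrow>
    (\<forall>k.
      X (Suc k) = (Z k ** transpose (Y k) + \<alpha> *\<^sub>R U k - \<Lambda> k)
                    ** matrix_inv (Y k ** transpose (Y k) + \<alpha> *\<^sub>R mat 1) \<and>
      Y (Suc k) = matrix_inv (transpose (X (Suc k)) ** X (Suc k) + \<beta> *\<^sub>R mat 1)
                    ** (transpose (X (Suc k)) ** Z k + \<beta> *\<^sub>R V k - \<Psi> k) \<and>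
      Z (Suc k) = X (Suc k) ** Y (Suc k) + proj_on \<Omega> (M - X (Suc k) ** Y (Suc k)) \<and>
      U (Suc k) = proj_nonneg (X (Suc k) + \<Lambda> k /\<^sub>R \<alpha>) \<and>
      V (Suc k) = proj_nonneg (Y (Suc k) + \<Psi> k /\<^sub>R \<beta>) \<and>
      \<Lambda> (Suc k) = \<Lambda> k + (\<gamma> * \<alpha>) *\<^sub>R (X (Suc k) - U (Suc k)) \<and>
      \<Psi> (Suc k) = \<Psi> k + (\<gamma> * \<beta>) *\<^sub>R (Y (Suc k) - V (Suc k)))"

text \<open>
  An accumulation point of a sequence is the limit of a subsequence; this differs from a limit
  point of the range, since a value attained infinitely often counts.
\<close>

definition accumulation_point :: "(nat \<Rightarrow> 'a::topological_space) \<Rightarrow> 'a \<Rightarrow> bool" where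
  "accumulation_point w l \<longleftrightarrow> (\<exists>r :: nat \<Rightarrow> nat. strict_mono r \<and> (w \<circ> r) \<longlonglongrightarrow> l)"

text \<open>
  KKT condition for minimising \<open>1/2 (frob_norm (X ** Y - Z))\<^sup>2\<close> over \<open>(U, V, X, Y, Z)\<close> subject to
  \<open>X = U\<close>, \<open>Y = V\<close>, \<open>U \<ge> 0\<close>, \<open>V \<ge> 0\<close> and \<open>proj_on \<Omega> (Z - M) = 0\<close>.
\<close>

definition KKT_split ::
  "('m \<times> 'n) set \<Rightarrow> real ^ 'n ^ 'm \<Rightarrow>
   real ^ 'q ^ 'm \<Rightarrow> real ^ 'n ^ 'q \<Rightarrow> real ^ 'n ^ 'm \<Rightarrow> real ^ 'q ^ 'm \<Rightarrow> real ^ 'n ^ 'q \<Rightarrow> bool" where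
  "KKT_split \<Omega> M X Y Z U V \<longleftrightarrow>
    (\<exists>(\<Lambda> :: real ^ 'q ^ 'm) (\<Psi> :: real ^ 'n ^ 'q).
      (X ** Y - Z) ** transpose Y + \<Lambda> = 0 \<and>
      transpose X ** (X ** Y - Z) + \<Psi> = 0 \<and>
      proj_on (- \<Omega>) (X ** Y - Z) = 0 \<and>
      proj_on \<Omega> (Z - M) = 0 \<and>
      X - U = 0 \<and> Y - V = 0 \<and>
      \<Lambda> \<le> 0 \<and> 0 \<le> U \<and> \<Lambda> * U = 0 \<and>
      \<Psi> \<le> 0 \<and> 0 \<le> V \<and> \<Psi> * V = 0)"

text \<open>
  KKT condition for minimising \<open>(frob_norm (proj_on \<Omega> (X ** Y - M)))\<^sup>2\<close> over \<open>X \<ge> 0\<close>, \<open>Y \<ge> 0\<close>,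
  with the factor 2 in the gradient dropped.
\<close>

definition KKT_nonneg ::
  "('m \<times> 'n) set \<Rightarrow> real ^ 'n ^ 'm \<Rightarrow> real ^ 'q ^ 'm \<Rightarrow> real ^ 'n ^ 'q \<Rightarrow> bool" where
  "KKT_nonneg \<Omega> M X Y \<longleftrightarrow>
    0 \<le> X \<and> 0 \<le> Y \<and>
    0 \<le> proj_on \<Omega> (X ** Y - M) ** transpose Y \<and>
    0 \<le> transpose X ** proj_on \<Omega> (X ** Y - M) \<and>
    X * (proj_on \<Omega> (X ** Y - M) ** transpose Y) = 0 \<and>
    Y * (transpose X ** proj_on \<Omega> (X ** Y - M)) = 0"

end

theory Submission
  imports Defs
begin

text \<open>
  The updates of \<open>X\<close>, \<open>Y\<close>, \<open>Z\<close>, \<open>U\<close>, \<open>V\<close> minimise the augmented Lagrangian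
  \<open>1/2 \<parallel>XY - Z\<parallel>\<^sup>2 + \<langle>\<Lambda>, X - U\<rangle> + \<alpha>/2 \<parallel>X - U\<parallel>\<^sup>2 + \<langle>\<Psi>, Y - V\<rangle> + \<beta>/2 \<parallel>Y - V\<parallel>\<^sup>2\<close>
  one block at a time. It is strongly convex in each block, so every update decreases it by a
  multiple of the squared step length, while the multiplier updates increase it by a multiple of
  \<open>\<parallel>\<Lambda>\<^sub>k\<^sub>+\<^sub>1 - \<Lambda>\<^sub>k\<parallel>\<^sup>2 + \<parallel>\<Psi>\<^sub>k\<^sub>+\<^sub>1 - \<Psi>\<^sub>k\<parallel>\<^sup>2\<close>, which is summable. Bounded multipliers bound it
  from below, so all steps tend to zero, and the update equations become the KKT conditions
  along any subsequence on which the iterates and the multipliers converge.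
\<close>

section \<open>Matrix products\<close>

lemma matrix_mult_nth: "(A ** B) $ i $ j = (\<Sum>k\<in>UNIV. A $ i $ k * B $ k $ j)"
  by (simp add: matrix_matrix_mult_def)

text \<open>Adjoint of right multiplication for the entrywise inner product. It turns the
  directional derivative of the fit term into an inner product with its gradient, which is the form
  in which optimality of the \<open>X\<close> update is known.\<close>

lemma inner_matrix_mult_left:
  fixes A :: "real ^ 'q ^ 'm" and B :: "real ^ 'n ^ 'q" and C :: "real ^ 'n ^ 'm"
  shows "inner C (A ** B) = inner (C ** transpose B) A"
proof -
  have "(\<Sum>j\<in>UNIV. C $ i $ j * (\<Sum>k\<in>UNIV. A $ i $ k * B $ k $ j)) =
        (\<Sum>k\<in>UNIV. (\<Sum>j\<in>UNIV. C $ i $ j * B $ k $ j) * A $ i $ k)" for i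
  proof -
    have "(\<Sum>j\<in>UNIV. C $ i $ j * (\<Sum>k\<in>UNIV. A $ i $ k * B $ k $ j)) =
          (\<Sum>j\<in>UNIV. \<Sum>k\<in>UNIV. C $ i $ j * B $ k $ j * A $ i $ k)"
      by (simp only: sum_distrib_left mult_ac)
    also have "\<dots> = (\<Sum>k\<in>UNIV. \<Sum>j\<in>UNIV. C $ i $ j * B $ k $ j * A $ i $ k)"
      by (rule sum.swap)
    also have "\<dots> = (\<Sum>k\<in>UNIV. (\<Sum>j\<in>UNIV. C $ i $ j * B $ k $ j) * A $ i $ k)"
      by (simp only: sum_distrib_right)
    finally show ?thesis .
  qed
  then show ?thesis
    unfolding inner_vec_def inner_real_def matrix_mult_nth transpose_def vec_lambda_beta
    by (rule sum.cong[OF refl])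
qed

lemma inner_transpose:
  fixes A B :: "real ^ 'n ^ 'm"
  shows "inner (transpose A) (transpose B) = inner A B"
  unfolding inner_vec_def transpose_def by simp (rule sum.swap)

lemma inner_matrix_mult_right:
  fixes A :: "real ^ 'q ^ 'm" and B :: "real ^ 'n ^ 'q" and C :: "real ^ 'n ^ 'm"
  shows "inner C (A ** B) = inner (transpose A ** C) B"
proof -
  have "inner C (A ** B) = inner (transpose C) (transpose B ** transpose A)"
    by (simp only: inner_transpose flip: matrix_transpose_mul)
  also have "\<dots> = inner (transpose (transpose A ** C)) (transpose B)"
    by (simp only: inner_matrix_mult_left matrix_transpose_mul transpose_transpose)
  finally show ?thesis
    by (simp only: inner_transpose)
qed

lemma bounded_bilinear_matrix_mult:
  "bounded_bilinear ((**) :: real ^ 'q ^ 'm \<Rightarrow> real ^ 'n ^ 'q \<Rightarrow> real ^ 'n ^ 'm)"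
  by (rule bilinear_conv_bounded_bilinear[THEN iffD1])
    (auto simp: bilinear_def vec_eq_iff matrix_mult_nth algebra_simps sum.distrib sum_distrib_left
      intro!: linearI)

lemmas tendsto_matrix_mult [tendsto_intros] =
  bounded_bilinear.tendsto[OF bounded_bilinear_matrix_mult]

lemma tendsto_transpose [tendsto_intros]:
  fixes f :: "'a \<Rightarrow> real ^ 'n ^ 'm"
  shows "(f \<longlongrightarrow> A) F \<Longrightarrow> ((\<lambda>x. transpose (f x)) \<longlongrightarrow> transpose A) F"
  unfolding transpose_def by (intro tendsto_intros)

text \<open>The quadratic form at \<open>x\<close> equals
  \<open>inner (A *v x) (A *v x) + c * inner x x\<close>, so the kernel is trivial, and a square
  matrix with trivial kernel is invertible.\<close>

lemma invertible_gram_add: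
  fixes A :: "real ^ 'n ^ 'm"
  assumes "c > 0"
  shows "invertible (transpose A ** A + c *\<^sub>R mat 1)"
proof -
  have "x = 0" if "(transpose A ** A + c *\<^sub>R mat 1) *v x = 0" for x
  proof -
    have "0 = inner x ((transpose A ** A + c *\<^sub>R mat 1) *v x)"
      using that by simp
    also have "\<dots> = inner (A *v x) (A *v x) + c * inner x x"
      by (simp add: matrix_vector_mult_add_rdistrib inner_add_right
          scaleR_matrix_vector_assoc[symmetric] matrix_vector_mul_assoc[symmetric]
          inner_commute[of x "_ v* _"] dot_lmul_matrix)
    finally have "c * inner x x \<le> 0"
      using inner_ge_zero[of "A *v x"] by linarith
    then show "x = 0"
      using assms by (metis inner_gt_zero_iff mult_pos_pos not_le)
  qed
  then show ?thesis
    by (simp add: invertible_left_inverse matrix_left_invertible_ker)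
qed

lemma matrix_inv:
  assumes "invertible A"
  shows matrix_mult_matrix_inv: "A ** matrix_inv A = mat 1"
    and matrix_inv_matrix_mult: "matrix_inv A ** A = mat 1"
  using someI_ex[OF assms[unfolded invertible_def]] by (simp_all add: matrix_inv_def)

text \<open>Multiplying the closed form by the inverted matrix gives back the normal equation, that
  is, a vanishing gradient in \<open>X\<close>. Being free of the inverse, this form serves both the
  descent estimate and the passage to the limit.\<close>

lemma regularized_least_squares_left:
  fixes X :: "real ^ 'q ^ 'm" and Y :: "real ^ 'n ^ 'q"
  assumes "c > 0"
    and X: "X = (Z ** transpose Y + c *\<^sub>R U - L) ** matrix_inv (Y ** transpose Y + c *\<^sub>R mat 1)"
  shows "(X ** Y - Z) ** transpose Y + (L + c *\<^sub>R (X - U)) = 0"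
proof -
  let ?G = "Y ** transpose Y + c *\<^sub>R mat 1"
  have "invertible ?G"
    using invertible_gram_add[OF \<open>c > 0\<close>, of "transpose Y"] by simp
  then have "X ** ?G = Z ** transpose Y + c *\<^sub>R U - L"
    by (simp add: X matrix_mul_assoc[symmetric] matrix_inv)
  moreover have "X ** ?G = X ** Y ** transpose Y + c *\<^sub>R X"
    by (simp only: matrix_add_ldistrib matrix_scalar_ac matrix_mul_rid matrix_mul_assoc)
  moreover have diff: "(X ** Y - Z) ** transpose Y = X ** Y ** transpose Y - Z ** transpose Y"
    by (rule bounded_bilinear.diff_left[OF bounded_bilinear_matrix_mult])
  ultimately show ?thesis
    unfolding diff by (simp add: scaleR_diff_right algebra_simps)
qed

lemma regularized_least_squares_right:
  fixes X :: "real ^ 'q ^ 'm" and Y :: "real ^ 'n ^ 'q"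
  assumes "c > 0"
    and Y: "Y = matrix_inv (transpose X ** X + c *\<^sub>R mat 1) ** (transpose X ** Z + c *\<^sub>R V - L)"
  shows "transpose X ** (X ** Y - Z) + (L + c *\<^sub>R (Y - V)) = 0"
proof -
  let ?G = "transpose X ** X + c *\<^sub>R mat 1"
  have "?G ** Y = transpose X ** Z + c *\<^sub>R V - L"
    using invertible_gram_add[OF \<open>c > 0\<close>, of X] by (simp add: Y matrix_mul_assoc matrix_inv)
  moreover have "?G ** Y = transpose X ** (X ** Y) + c *\<^sub>R Y"
    by (simp only: bounded_bilinear.add_left[OF bounded_bilinear_matrix_mult]
        scalar_matrix_assoc[symmetric] matrix_mul_lid matrix_mul_assoc)
  moreover have diff: "transpose X ** (X ** Y - Z) = transpose X ** (X ** Y) - transpose X ** Z"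
    by (rule bounded_bilinear.diff_right[OF bounded_bilinear_matrix_mult])
  ultimately show ?thesis
    unfolding diff by (simp add: scaleR_diff_right algebra_simps)
qed

lemma tendsto_Pair_iff:
  "((\<lambda>x. (f x, g x)) \<longlongrightarrow> (a, b)) F \<longleftrightarrow> (f \<longlongrightarrow> a) F \<and> (g \<longlongrightarrow> b) F"
  using tendsto_fst[of "\<lambda>x. (f x, g x)"] tendsto_snd[of "\<lambda>x. (f x, g x)"] tendsto_Pair[of f a F g b]
  by auto

section \<open>Projections\<close>

lemma proj_on_nth: "proj_on S A $ i $ j = (if (i, j) \<in> S then A $ i $ j else 0)"
  by (simp add: proj_on_def)

lemma proj_nonneg_nth: "proj_nonneg A $ i $ j = max (A $ i $ j) 0"
  by (simp add: proj_nonneg_def)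

lemma tendsto_proj_on [tendsto_intros]:
  assumes "(f \<longlongrightarrow> A) F"
  shows "((\<lambda>x. proj_on S (f x)) \<longlongrightarrow> proj_on S A) F"
proof (intro vec_tendstoI)
  fix i j
  have "((\<lambda>x. f x $ i $ j) \<longlongrightarrow> A $ i $ j) F"
    by (intro tendsto_vec_nth assms)
  then show "((\<lambda>x. proj_on S (f x) $ i $ j) \<longlongrightarrow> proj_on S A $ i $ j) F"
    by (cases "(i, j) \<in> S") (simp_all add: proj_on_nth)
qed

lemma tendsto_proj_nonneg [tendsto_intros]:
  "(f \<longlongrightarrow> A) F \<Longrightarrow> ((\<lambda>x. proj_nonneg (f x)) \<longlongrightarrow> proj_nonneg A) F"
  unfolding proj_nonneg_def by (intro tendsto_intros)

lemma proj_nonneg_ge_0: "0 \<le> proj_nonneg A"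
  by (simp add: less_eq_vec_def proj_nonneg_nth)

text \<open>Variational inequality of the projection onto the nonnegative orthant. Entrywise, either
  the projection leaves \<open>A\<close> unchanged and the first factor is 0, or it returns 0 and
  both factors are nonnegative.\<close>

lemma inner_proj_nonneg_ge_0:
  assumes "0 \<le> U"
  shows "0 \<le> inner (proj_nonneg A - A) (U - proj_nonneg A)"
  unfolding inner_vec_def
proof (intro sum_nonneg)
  fix i j
  have "0 \<le> U $ i $ j"
    using assms by (simp add: less_eq_vec_def)
  then show "0 \<le> inner ((proj_nonneg A - A) $ i $ j) ((U - proj_nonneg A) $ i $ j)"
    by (auto simp: proj_nonneg_nth max_def mult_nonpos_nonneg)
qed

text \<open>Complementarity as a fixed-point equation: in each entry the maximum is attained by the
  first argument, forcing \<open>L\<close> to vanish there, or by 0, forcing \<open>U\<close> to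
  vanish and \<open>L\<close> to be nonpositive.\<close>

lemma proj_nonneg_fixed_pointD:
  fixes U L :: "real ^ 'n ^ 'm"
  assumes "c > 0" and U: "U = proj_nonneg (U + L /\<^sub>R c)"
  shows "L \<le> 0" "0 \<le> U" "L * U = 0"
proof -
  have "L $ i $ j \<le> 0 \<and> 0 \<le> U $ i $ j \<and> L $ i $ j * U $ i $ j = 0" for i j
  proof -
    have "U $ i $ j = max (U $ i $ j + L $ i $ j / c) 0"
      using arg_cong[OF U, of "\<lambda>A. A $ i $ j"] by (simp add: proj_nonneg_nth divide_inverse_commute)
    then show ?thesis
      using \<open>c > 0\<close> by (auto simp: max_def divide_le_0_iff split: if_splits)
  qed
  then show "L \<le> 0" "0 \<le> U" "L * U = 0"
    by (auto simp: less_eq_vec_def vec_eq_iff)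
qed

section \<open>Sufficient decrease\<close>

text \<open>
  The hypothesis is the variational inequality of the minimiser \<open>p\<close>, tested at \<open>x\<close> only.
\<close>

lemma quadratic_decrease:
  fixes T :: "'a::real_inner \<Rightarrow> 'b::real_inner"
  assumes "linear T"
    and opt: "0 \<le> inner (T p - z) (T (x - p)) + inner (l + c *\<^sub>R (p - u)) (x - p)"
  shows "(norm (T p - z))\<^sup>2 / 2 + inner l (p - u) + c / 2 * (norm (p - u))\<^sup>2
           + c / 2 * (norm (x - p))\<^sup>2
         \<le> (norm (T x - z))\<^sup>2 / 2 + inner l (x - u) + c / 2 * (norm (x - u))\<^sup>2"
proof -
  have 1: "T x - z = (T p - z) + T (x - p)" and 2: "x - u = (p - u) + (x - p)"
    using \<open>linear T\<close> by (simp_all add: linear_diff)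
  have norm_add: "(norm (a + b))\<^sup>2 = (norm a)\<^sup>2 + 2 * inner a b + (norm b)\<^sup>2"
    for a b :: "'c::real_inner"
    by (simp add: power2_norm_eq_inner inner_add_left inner_add_right inner_commute)
  \<comment> \<open>Exact expansion of the quadratic around \<open>p\<close>: the linear part is
    nonnegative by \<open>opt\<close>, and the square of \<open>T (x - p)\<close> is discarded at
    the end.\<close>
  have "(norm (T x - z))\<^sup>2 / 2 + inner l (x - u) + c / 2 * (norm (x - u))\<^sup>2
      = (norm (T p - z))\<^sup>2 / 2 + inner l (p - u) + c / 2 * (norm (p - u))\<^sup>2
           + c / 2 * (norm (x - p))\<^sup>2
        + (inner (T p - z) (T (x - p)) + inner (l + c *\<^sub>R (p - u)) (x - p))
        + (norm (T (x - p)))\<^sup>2 / 2"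
    unfolding 1 2 norm_add inner_add_left inner_add_right[of l] inner_scaleR_left
    by (simp add: field_simps)
  then show ?thesis
    using opt zero_le_power2[of "norm (T (x - p))"] by linarith
qed

text \<open>Completing the square. The bound is uniform in \<open>d\<close>, so a bounded multiplier
  keeps its term together with the penalty bounded below whatever the residual is.\<close>

lemma inner_add_norm_sq_ge:
  fixes l d :: "'a::real_inner"
  assumes "c > 0" "norm l \<le> C"
  shows "- (C\<^sup>2 / (2 * c)) \<le> inner l d + c / 2 * (norm d)\<^sup>2"
proof -
  have "(norm (l + c *\<^sub>R d))\<^sup>2 = (norm l)\<^sup>2 + 2 * c * (inner l d + c / 2 * (norm d)\<^sup>2)"
    by (simp add: power2_norm_eq_inner inner_add_left inner_add_right inner_commute
        algebra_simps)
  moreover have "(norm l)\<^sup>2 \<le> C\<^sup>2"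
    using assms by (intro power_mono) auto
  ultimately have "- (C\<^sup>2) \<le> 2 * c * (inner l d + c / 2 * (norm d)\<^sup>2)"
    using zero_le_power2[of "norm (l + c *\<^sub>R d)"] by linarith
  then show ?thesis
    using \<open>c > 0\<close> by (simp add: field_simps)
qed

text \<open>Telescoping: the total decrease is at most the initial gap above \<open>B\<close> plus
  the total of the errors \<open>e\<close>.\<close>

lemma summable_decrease:
  fixes f D e :: "nat \<Rightarrow> real"
  assumes D: "\<And>k. 0 \<le> D k" and e: "\<And>k. 0 \<le> e k" "summable e"
    and step: "\<And>k. f (Suc k) + D k \<le> f k + e k" and bound: "\<And>k. B \<le> f k"
  shows "summable D"
proof (rule summableI_nonneg_bounded)
  show "sum D {..<N} \<le> f 0 - B + suminf e" for N
  proof -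
    have "f N + sum D {..<N} \<le> f 0 + sum e {..<N}"
    proof (induction N)
      case (Suc N)
      with step[of N] show ?case by simp
    qed simp
    moreover have "sum e {..<N} \<le> suminf e"
      using e by (intro sum_le_suminf) auto
    ultimately show ?thesis
      using bound[of N] by linarith
  qed
qed (rule D)

lemma tendsto_0_if_norm_sq_le:
  fixes f :: "nat \<Rightarrow> 'a::real_normed_vector"
  assumes "D \<longlonglongrightarrow> 0" "c > 0" "\<And>k. c * (norm (f k))\<^sup>2 \<le> D k"
  shows "f \<longlonglongrightarrow> 0"
proof -
  have "(\<lambda>k. (norm (f k))\<^sup>2) \<longlonglongrightarrow> 0"
  proof (rule tendsto_sandwich[OF _ _ tendsto_const])
    show "(\<lambda>k. D k / c) \<longlonglongrightarrow> 0"
      using tendsto_divide[OF assms(1) tendsto_const, of c] \<open>c > 0\<close> by simp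
  qed (use assms in \<open>auto simp: pos_le_divide_eq mult.commute\<close>)
  then have "(\<lambda>k. sqrt ((norm (f k))\<^sup>2)) \<longlonglongrightarrow> sqrt 0"
    by (rule tendsto_real_sqrt)
  then show ?thesis
    by (simp add: tendsto_norm_zero_iff)
qed

text \<open>Only \<open>X = U\<close> and \<open>Y = V\<close> are dualised. The sign constraints
  and the data constraint on \<open>Z\<close> are enforced by the updates themselves.\<close>

definition aug_lagrangian where
  "aug_lagrangian \<alpha> \<beta> X Y Z U V \<Lambda> \<Psi> =
     (norm (X ** Y - Z))\<^sup>2 / 2
     + inner \<Lambda> (X - U) + \<alpha> / 2 * (norm (X - U))\<^sup>2
     + inner \<Psi> (Y - V) + \<beta> / 2 * (norm (Y - V))\<^sup>2"
  for X U \<Lambda> :: "real ^ 'q ^ 'm" and Y V \<Psi> :: "real ^ 'n ^ 'q"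

section \<open>The iteration\<close>

locale adm =
  fixes M :: "real ^ 'n ^ 'm" and \<Omega> :: "('m \<times> 'n) set" and \<alpha> \<beta> \<gamma> :: real
    and X U \<Lambda> :: "nat \<Rightarrow> real ^ 'q ^ 'm"
    and Y V \<Psi> :: "nat \<Rightarrow> real ^ 'n ^ 'q"
    and Z :: "nat \<Rightarrow> real ^ 'n ^ 'm"
  assumes pos: "\<alpha> > 0" "\<beta> > 0" "\<gamma> > 0"
    and adm: "adm_sequence \<Omega> M \<alpha> \<beta> \<gamma> X Y Z U V \<Lambda> \<Psi>"
    and multipliers_bounded: "bounded (range (\<lambda>k. (\<Lambda> k, \<Psi> k)))"
    and multipliers_summable:
      "summable (\<lambda>k. (norm (\<Lambda> (Suc k) - \<Lambda> k))\<^sup>2 + (norm (\<Psi> (Suc k) - \<Psi> k))\<^sup>2)"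
begin

section \<open>Update equations and stationarity in \<open>X\<close> and \<open>Y\<close>\<close>

lemma X_Suc: "X (Suc k) = (Z k ** transpose (Y k) + \<alpha> *\<^sub>R U k - \<Lambda> k)
        ** matrix_inv (Y k ** transpose (Y k) + \<alpha> *\<^sub>R mat 1)"
  and Y_Suc: "Y (Suc k) = matrix_inv (transpose (X (Suc k)) ** X (Suc k) + \<beta> *\<^sub>R mat 1)
        ** (transpose (X (Suc k)) ** Z k + \<beta> *\<^sub>R V k - \<Psi> k)"
  and Z_Suc: "Z (Suc k) = X (Suc k) ** Y (Suc k) + proj_on \<Omega> (M - X (Suc k) ** Y (Suc k))"
  and U_Suc: "U (Suc k) = proj_nonneg (X (Suc k) + \<Lambda> k /\<^sub>R \<alpha>)"
  and V_Suc: "V (Suc k) = proj_nonneg (Y (Suc k) + \<Psi> k /\<^sub>R \<beta>)"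
  and \<Lambda>_Suc: "\<Lambda> (Suc k) = \<Lambda> k + (\<gamma> * \<alpha>) *\<^sub>R (X (Suc k) - U (Suc k))"
  and \<Psi>_Suc: "\<Psi> (Suc k) = \<Psi> k + (\<gamma> * \<beta>) *\<^sub>R (Y (Suc k) - V (Suc k))"
  using adm[unfolded adm_sequence_def, rule_format, of k] by - (elim conjE, assumption)+

lemma X_optimal:
  "(X (Suc k) ** Y k - Z k) ** transpose (Y k) + (\<Lambda> k + \<alpha> *\<^sub>R (X (Suc k) - U k)) = 0"
  by (rule regularized_least_squares_left[OF pos(1) X_Suc])

lemma Y_optimal:
  "transpose (X (Suc k)) ** (X (Suc k) ** Y (Suc k) - Z k) + (\<Psi> k + \<beta> *\<^sub>R (Y (Suc k) - V k)) = 0"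
  by (rule regularized_least_squares_right[OF pos(2) Y_Suc])

section \<open>Change of the augmented Lagrangian over one iteration\<close>

definition lagr :: "nat \<Rightarrow> real" where
  "lagr k = aug_lagrangian \<alpha> \<beta> (X k) (Y k) (Z k) (U k) (V k) (\<Lambda> k) (\<Psi> k)"

text \<open>Each coefficient is half the strong convexity modulus of the block: \<alpha> for
  \<open>X\<close> and \<open>U\<close>, \<beta> for \<open>Y\<close> and \<open>V\<close>, 1 for
  \<open>Z\<close>.\<close>

definition decr :: "nat \<Rightarrow> real" where
  "decr k = \<alpha> / 2 * (norm (X k - X (Suc k)))\<^sup>2 + \<beta> / 2 * (norm (Y k - Y (Suc k)))\<^sup>2
     + 1 / 2 * (norm (Z k - Z (Suc k)))\<^sup>2
     + \<alpha> / 2 * (norm (U k - U (Suc k)))\<^sup>2 + \<beta> / 2 * (norm (V k - V (Suc k)))\<^sup>2"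

definition incr :: "nat \<Rightarrow> real" where
  "incr k = (norm (\<Lambda> (Suc k) - \<Lambda> k))\<^sup>2 / (\<gamma> * \<alpha>) + (norm (\<Psi> (Suc k) - \<Psi> k))\<^sup>2 / (\<gamma> * \<beta>)"

lemma X_decrease:
  "aug_lagrangian \<alpha> \<beta> (X (Suc k)) (Y k) (Z k) (U k) (V k) (\<Lambda> k) (\<Psi> k)
     + \<alpha> / 2 * (norm (X k - X (Suc k)))\<^sup>2
   \<le> aug_lagrangian \<alpha> \<beta> (X k) (Y k) (Z k) (U k) (V k) (\<Lambda> k) (\<Psi> k)"
proof -
  have "linear (\<lambda>A. A ** Y k)"
    by (rule bounded_linear.linear[OF
          bounded_bilinear.bounded_linear_left[OF bounded_bilinear_matrix_mult]])
  \<comment> \<open>Moving the product to the other side by the adjoint turns the first-order term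
    into an inner product with the left side of \<open>X_optimal\<close>, which is 0.\<close>
  from quadratic_decrease[OF this, of "X (Suc k)" "Z k" "X k" "\<Lambda> k" \<alpha> "U k"]
  show ?thesis
    by (simp add: aug_lagrangian_def inner_matrix_mult_left inner_add_left[symmetric] X_optimal)
qed

lemma Y_decrease:
  "aug_lagrangian \<alpha> \<beta> (X (Suc k)) (Y (Suc k)) (Z k) (U k) (V k) (\<Lambda> k) (\<Psi> k)
     + \<beta> / 2 * (norm (Y k - Y (Suc k)))\<^sup>2
   \<le> aug_lagrangian \<alpha> \<beta> (X (Suc k)) (Y k) (Z k) (U k) (V k) (\<Lambda> k) (\<Psi> k)"
proof -
  have "linear (\<lambda>A. X (Suc k) ** A)"
    by (rule bounded_linear.linear[OF
          bounded_bilinear.bounded_linear_right[OF bounded_bilinear_matrix_mult]])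
  from quadratic_decrease[OF this, of "Y (Suc k)" "Z k" "Y k" "\<Psi> k" \<beta> "V k"]
  show ?thesis
    by (simp add: aug_lagrangian_def inner_matrix_mult_right inner_add_left[symmetric] Y_optimal)
qed

text \<open>
  The initial \<open>Z\<close>, \<open>U\<close>, \<open>V\<close> need not be feasible, so their decrease is only available from
  iterate 1 on.
\<close>

lemma Z_decrease:
  assumes "k > 0"
  shows "aug_lagrangian \<alpha> \<beta> (X (Suc k)) (Y (Suc k)) (Z (Suc k)) (U k) (V k) (\<Lambda> k) (\<Psi> k)
     + 1 / 2 * (norm (Z k - Z (Suc k)))\<^sup>2
   \<le> aug_lagrangian \<alpha> \<beta> (X (Suc k)) (Y (Suc k)) (Z k) (U k) (V k) (\<Lambda> k) (\<Psi> k)"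
proof -
  let ?P = "X (Suc k) ** Y (Suc k)"
  obtain k' where k': "k = Suc k'"
    using assms gr0_implies_Suc by blast
  \<comment> \<open>The first factor vanishes off \<Omega>; on \<Omega> both \<open>Z k\<close> and
    \<open>Z (Suc k)\<close> agree with \<open>M\<close>, so the second one does.\<close>
  have "inner (Z (Suc k) - ?P) (Z k - Z (Suc k)) = 0"
    unfolding Z_Suc k'
    by (auto simp: inner_vec_def proj_on_nth intro!: sum.neutral)
  \<comment> \<open>With the zero map as \<open>T\<close>, the fit term plays the role of the
    penalty: weight 1, centre \<open>?P\<close>.\<close>
  with quadratic_decrease[OF linear_zero, where z = "0 :: real" and x = "Z k" and p = "Z (Suc k)"
      and l = 0 and c = 1 and u = ?P]
  show ?thesis
    by (simp add: aug_lagrangian_def norm_minus_commute)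
qed

lemma UV_decrease:
  assumes "k > 0"
  shows "aug_lagrangian \<alpha> \<beta> (X (Suc k)) (Y (Suc k)) (Z (Suc k)) (U (Suc k)) (V (Suc k)) (\<Lambda> k) (\<Psi> k)
     + \<alpha> / 2 * (norm (U k - U (Suc k)))\<^sup>2 + \<beta> / 2 * (norm (V k - V (Suc k)))\<^sup>2
   \<le> aug_lagrangian \<alpha> \<beta> (X (Suc k)) (Y (Suc k)) (Z (Suc k)) (U k) (V k) (\<Lambda> k) (\<Psi> k)"
proof -
  obtain k' where k': "k = Suc k'"
    using assms gr0_implies_Suc by blast
  have projection:
    "inner L (A - proj_nonneg (A + L /\<^sub>R c)) + c / 2 * (norm (A - proj_nonneg (A + L /\<^sub>R c)))\<^sup>2
       + c / 2 * (norm (B - proj_nonneg (A + L /\<^sub>R c)))\<^sup>2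
     \<le> inner L (A - B) + c / 2 * (norm (A - B))\<^sup>2"
    if "0 \<le> B" "c > 0" for A B L :: "real ^ 'i ^ 'j" and c
  proof -
    let ?p = "proj_nonneg (A + L /\<^sub>R c)"
    \<comment> \<open>The multiplier changes sign because \<open>U\<close> enters the Lagrangian
      through \<open>X - U\<close>. The gradient in \<open>U\<close> is then \<open>c\<close> times
      the displacement made by the projection.\<close>
    have "- L + c *\<^sub>R (?p - A) = c *\<^sub>R (?p - (A + L /\<^sub>R c))"
      using \<open>c > 0\<close> by (simp add: algebra_simps)
    then have "0 \<le> inner (- L + c *\<^sub>R (?p - A)) (B - ?p)"
      using inner_proj_nonneg_ge_0[OF \<open>0 \<le> B\<close>] \<open>c > 0\<close> by simp
    with quadratic_decrease[OF linear_zero, where z = "0 :: real" and x = B and p = ?p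
        and l = "- L" and c = c and u = A] show ?thesis
      by (simp add: norm_minus_commute inner_diff_right)
  qed
  have "0 \<le> U k" "0 \<le> V k"
    by (simp_all add: k' U_Suc V_Suc proj_nonneg_ge_0)
  from projection[OF this(1) pos(1), of "\<Lambda> k" "X (Suc k)"]
    projection[OF this(2) pos(2), of "\<Psi> k" "Y (Suc k)"]
  show ?thesis
    by (simp add: aug_lagrangian_def U_Suc[symmetric] V_Suc[symmetric])
qed

text \<open>Only the multiplier terms change, and each residual is the multiplier step divided by
  \<open>\<gamma> * \<alpha>\<close> or \<open>\<gamma> * \<beta>\<close>, so their inner product is
  a scaled squared norm.\<close>

lemma multiplier_increase:
  "lagr (Suc k) =
   aug_lagrangian \<alpha> \<beta> (X (Suc k)) (Y (Suc k)) (Z (Suc k)) (U (Suc k)) (V (Suc k)) (\<Lambda> k) (\<Psi> k)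
     + incr k"
proof -
  have "(norm (\<Lambda> (Suc k) - \<Lambda> k))\<^sup>2 / (\<gamma> * \<alpha>) = inner (\<Lambda> (Suc k) - \<Lambda> k) (X (Suc k) - U (Suc k))"
    "(norm (\<Psi> (Suc k) - \<Psi> k))\<^sup>2 / (\<gamma> * \<beta>) = inner (\<Psi> (Suc k) - \<Psi> k) (Y (Suc k) - V (Suc k))"
    using pos by (simp_all add: \<Lambda>_Suc \<Psi>_Suc dot_square_norm power_mult_distrib power2_eq_square)
  then show ?thesis
    by (simp add: lagr_def aug_lagrangian_def incr_def inner_diff_left)
qed

lemma lagr_step:
  assumes "k > 0"
  shows "lagr (Suc k) + decr k \<le> lagr k + incr k"
  using X_decrease[of k] Y_decrease[of k] Z_decrease[OF assms] UV_decrease[OF assms]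
    multiplier_increase[of k]
  unfolding decr_def lagr_def[of k] by linarith

section \<open>Vanishing steps and residuals\<close>

lemma lagr_bounded_below: "\<exists>B. \<forall>k. B \<le> lagr k"
proof -
  obtain C where C: "norm (\<Lambda> k, \<Psi> k) \<le> C" for k
    using multipliers_bounded unfolding bounded_iff by auto
  have "norm (\<Lambda> k) \<le> C" "norm (\<Psi> k) \<le> C" for k
    using order_trans[OF _ C] norm_fst_le norm_snd_le by blast+
  from inner_add_norm_sq_ge[OF pos(1) this(1)] inner_add_norm_sq_ge[OF pos(2) this(2)]
  have "- (C\<^sup>2 / (2 * \<alpha>)) - C\<^sup>2 / (2 * \<beta>) \<le> lagr k" for k
    unfolding lagr_def aug_lagrangian_def
    by (smt (verit) zero_le_power2 divide_nonneg_pos)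
  then show ?thesis
    by blast
qed

lemma summable_multipliers:
  "summable (\<lambda>k. (norm (\<Lambda> (Suc k) - \<Lambda> k))\<^sup>2)" "summable (\<lambda>k. (norm (\<Psi> (Suc k) - \<Psi> k))\<^sup>2)"
  by (rule summable_comparison_test'[OF multipliers_summable, of 0]; simp)+

lemma decr_tendsto_0: "decr \<longlonglongrightarrow> 0"
proof -
  obtain B where B: "\<And>k. B \<le> lagr k"
    using lagr_bounded_below by auto
  have "summable incr"
    unfolding incr_def by (intro summable_add summable_divide summable_multipliers)
  \<comment> \<open>All sequences are shifted by one index because \<open>lagr_step\<close> starts
    at 1; summability is unaffected.\<close>
  then have incr: "summable (\<lambda>k. incr (Suc k))"
    by (subst summable_Suc_iff)
  have nonneg: "0 \<le> incr k" "0 \<le> decr k" for k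
    using pos by (simp_all add: incr_def decr_def)
  have "summable (\<lambda>k. decr (Suc k))"
    by (rule summable_decrease[where f = "\<lambda>k. lagr (Suc k)" and e = "\<lambda>k. incr (Suc k)", OF _ _ incr])
      (rule nonneg lagr_step zero_less_Suc B)+
  then have "summable decr"
    by (subst (asm) summable_Suc_iff)
  then show ?thesis
    by (rule summable_LIMSEQ_zero)
qed

lemma steps_tendsto_0:
  "(\<lambda>k. X k - X (Suc k)) \<longlonglongrightarrow> 0" "(\<lambda>k. Y k - Y (Suc k)) \<longlonglongrightarrow> 0" "(\<lambda>k. Z k - Z (Suc k)) \<longlonglongrightarrow> 0"
  "(\<lambda>k. U k - U (Suc k)) \<longlonglongrightarrow> 0" "(\<lambda>k. V k - V (Suc k)) \<longlonglongrightarrow> 0"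
proof -
  have le: "\<alpha> / 2 * (norm (X k - X (Suc k)))\<^sup>2 \<le> decr k" "\<beta> / 2 * (norm (Y k - Y (Suc k)))\<^sup>2 \<le> decr k"
    "1 / 2 * (norm (Z k - Z (Suc k)))\<^sup>2 \<le> decr k"
    "\<alpha> / 2 * (norm (U k - U (Suc k)))\<^sup>2 \<le> decr k" "\<beta> / 2 * (norm (V k - V (Suc k)))\<^sup>2 \<le> decr k"
    for k
    using pos by (simp_all add: decr_def)
  have "\<alpha> / 2 > 0" "\<beta> / 2 > 0" "1 / 2 > (0 :: real)"
    using pos by simp_all
  note lim = this[THEN tendsto_0_if_norm_sq_le[OF decr_tendsto_0]]
  show "(\<lambda>k. X k - X (Suc k)) \<longlonglongrightarrow> 0" "(\<lambda>k. Y k - Y (Suc k)) \<longlonglongrightarrow> 0" "(\<lambda>k. Z k - Z (Suc k)) \<longlonglongrightarrow> 0"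
    "(\<lambda>k. U k - U (Suc k)) \<longlonglongrightarrow> 0" "(\<lambda>k. V k - V (Suc k)) \<longlonglongrightarrow> 0"
    by (rule lim(1)[OF le(1)] lim(2)[OF le(2)] lim(3)[OF le(3)] lim(1)[OF le(4)] lim(2)[OF le(5)])+
qed

lemma residual_tendsto_0: "(\<lambda>k. X k - U k) \<longlonglongrightarrow> 0" "(\<lambda>k. Y k - V k) \<longlonglongrightarrow> 0"
proof -
  have "(\<gamma> * \<alpha>)\<^sup>2 * (norm (X (Suc k) - U (Suc k)))\<^sup>2 \<le> (norm (\<Lambda> (Suc k) - \<Lambda> k))\<^sup>2" for k
    by (simp add: \<Lambda>_Suc power_mult_distrib)
  then have "(\<lambda>k. X (Suc k) - U (Suc k)) \<longlonglongrightarrow> 0"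
    by (rule tendsto_0_if_norm_sq_le[OF summable_LIMSEQ_zero[OF summable_multipliers(1)], rotated])
      (use pos in simp)
  then show "(\<lambda>k. X k - U k) \<longlonglongrightarrow> 0"
    by (rule LIMSEQ_imp_Suc[of "\<lambda>k. X k - U k"])
  have "(\<gamma> * \<beta>)\<^sup>2 * (norm (Y (Suc k) - V (Suc k)))\<^sup>2 \<le> (norm (\<Psi> (Suc k) - \<Psi> k))\<^sup>2" for k
    by (simp add: \<Psi>_Suc power_mult_distrib)
  then have "(\<lambda>k. Y (Suc k) - V (Suc k)) \<longlonglongrightarrow> 0"
    by (rule tendsto_0_if_norm_sq_le[OF summable_LIMSEQ_zero[OF summable_multipliers(2)], rotated])
      (use pos in simp)
  then show "(\<lambda>k. Y k - V k) \<longlonglongrightarrow> 0"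
    by (rule LIMSEQ_imp_Suc[of "\<lambda>k. Y k - V k"])
qed

section \<open>Passage to the limit\<close>

lemma KKT_split_limit:
  assumes r: "strict_mono r"
    and lim: "(\<lambda>k. X (r k)) \<longlonglongrightarrow> X'" "(\<lambda>k. Y (r k)) \<longlonglongrightarrow> Y'" "(\<lambda>k. Z (r k)) \<longlonglongrightarrow> Z'"
      "(\<lambda>k. U (r k)) \<longlonglongrightarrow> U'" "(\<lambda>k. V (r k)) \<longlonglongrightarrow> V'"
      "(\<lambda>k. \<Lambda> (r k)) \<longlonglongrightarrow> \<Lambda>'" "(\<lambda>k. \<Psi> (r k)) \<longlonglongrightarrow> \<Psi>'"
  shows "KKT_split \<Omega> M X' Y' Z' U' V'"
proof -
  have subseq: "(\<lambda>k. f (r k)) \<longlonglongrightarrow> l" if "f \<longlonglongrightarrow> l" for f :: "nat \<Rightarrow> 'a::topological_space" and l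
    using LIMSEQ_subseq_LIMSEQ[OF that r] by (simp add: o_def)
  \<comment> \<open>The index \<open>Suc (r k)\<close> need not belong to the subsequence, but
    vanishing steps give the shifted iterates the same limit.\<close>
  have Suc_lim: "(\<lambda>k. f (Suc (r k))) \<longlonglongrightarrow> l"
    if "(\<lambda>k. f (r k)) \<longlonglongrightarrow> l" "(\<lambda>k. f k - f (Suc k)) \<longlonglongrightarrow> 0"
    for f :: "nat \<Rightarrow> 'b::real_normed_vector" and l
    using tendsto_diff[OF that(1) subseq[OF that(2)]] by simp
  note lims = lim Suc_lim[OF lim(1) steps_tendsto_0(1)] Suc_lim[OF lim(2) steps_tendsto_0(2)]
    Suc_lim[OF lim(3) steps_tendsto_0(3)] Suc_lim[OF lim(4) steps_tendsto_0(4)]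
    Suc_lim[OF lim(5) steps_tendsto_0(5)]
  have UV: "X' = U'" "Y' = V'"
    using LIMSEQ_unique[OF tendsto_diff[OF lim(1,4)] subseq[OF residual_tendsto_0(1)]]
      LIMSEQ_unique[OF tendsto_diff[OF lim(2,5)] subseq[OF residual_tendsto_0(2)]]
    by simp_all
  \<comment> \<open>The sequence is constantly 0 by \<open>X_optimal\<close>, and the penalty part
    of its limit drops out since \<open>X' = U'\<close>.\<close>
  have "(\<lambda>k. (X (Suc (r k)) ** Y (r k) - Z (r k)) ** transpose (Y (r k))
            + (\<Lambda> (r k) + \<alpha> *\<^sub>R (X (Suc (r k)) - U (r k))))
        \<longlonglongrightarrow> (X' ** Y' - Z') ** transpose Y' + (\<Lambda>' + \<alpha> *\<^sub>R (X' - U'))"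
    by (intro tendsto_intros lims)
  then have X: "(X' ** Y' - Z') ** transpose Y' + \<Lambda>' = 0"
    by (simp add: X_optimal UV LIMSEQ_const_iff)
  have "(\<lambda>k. transpose (X (Suc (r k))) ** (X (Suc (r k)) ** Y (Suc (r k)) - Z (r k))
            + (\<Psi> (r k) + \<beta> *\<^sub>R (Y (Suc (r k)) - V (r k))))
        \<longlonglongrightarrow> transpose X' ** (X' ** Y' - Z') + (\<Psi>' + \<beta> *\<^sub>R (Y' - V'))"
    by (intro tendsto_intros lims)
  then have Y: "transpose X' ** (X' ** Y' - Z') + \<Psi>' = 0"
    by (simp add: Y_optimal UV LIMSEQ_const_iff)
  have "(\<lambda>k. Z (Suc (r k))) \<longlonglongrightarrow> X' ** Y' + proj_on \<Omega> (M - X' ** Y')"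
    unfolding Z_Suc by (intro tendsto_intros lims)
  then have Z: "Z' = X' ** Y' + proj_on \<Omega> (M - X' ** Y')"
    using lims LIMSEQ_unique by blast
  \<comment> \<open>In the limit the update of \<open>U\<close> becomes the fixed-point equation
    that encodes the sign and complementarity conditions.\<close>
  have "(\<lambda>k. U (Suc (r k))) \<longlonglongrightarrow> proj_nonneg (X' + \<Lambda>' /\<^sub>R \<alpha>)"
    unfolding U_Suc by (intro tendsto_intros lims)
  then have U: "U' = proj_nonneg (U' + \<Lambda>' /\<^sub>R \<alpha>)"
    using lims LIMSEQ_unique UV by blast
  have "(\<lambda>k. V (Suc (r k))) \<longlonglongrightarrow> proj_nonneg (Y' + \<Psi>' /\<^sub>R \<beta>)"
    unfolding V_Suc by (intro tendsto_intros lims)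
  then have V: "V' = proj_nonneg (V' + \<Psi>' /\<^sub>R \<beta>)"
    using lims LIMSEQ_unique UV by blast
  have "proj_on (- \<Omega>) (X' ** Y' - Z') = 0" "proj_on \<Omega> (Z' - M) = 0"
    by (simp_all add: Z vec_eq_iff proj_on_nth)
  with X Y UV proj_nonneg_fixed_pointD[OF pos(1) U] proj_nonneg_fixed_pointD[OF pos(2) V]
  show ?thesis
    unfolding KKT_split_def by (metis diff_self)
qed

lemma KKT_split_accumulation_point:
  assumes "accumulation_point (\<lambda>k. (X k, Y k, Z k, U k, V k)) (X', Y', Z', U', V')"
  shows "KKT_split \<Omega> M X' Y' Z' U' V'"
proof -
  obtain r where r: "strict_mono r"
    and "(\<lambda>k. (X (r k), Y (r k), Z (r k), U (r k), V (r k))) \<longlonglongrightarrow> (X', Y', Z', U', V')"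
    using assms by (auto simp: accumulation_point_def o_def)
  then have lim: "(\<lambda>k. X (r k)) \<longlonglongrightarrow> X'" "(\<lambda>k. Y (r k)) \<longlonglongrightarrow> Y'" "(\<lambda>k. Z (r k)) \<longlonglongrightarrow> Z'"
      "(\<lambda>k. U (r k)) \<longlonglongrightarrow> U'" "(\<lambda>k. V (r k)) \<longlonglongrightarrow> V'"
    by (auto simp: tendsto_Pair_iff)
  have "bounded (range (\<lambda>k. (\<Lambda> (r k), \<Psi> (r k))))"
    using multipliers_bounded by (rule bounded_subset) auto
  \<comment> \<open>The multipliers need not converge along \<open>r\<close>; by compactness they do
    along a further subsequence, and their limits are the KKT multipliers.\<close>
  from bounded_imp_convergent_subsequence[OF this] obtain \<Lambda>' \<Psi>' s where s: "strict_mono s"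
    and "(\<lambda>k. (\<Lambda> (r (s k)), \<Psi> (r (s k)))) \<longlonglongrightarrow> (\<Lambda>', \<Psi>')"
    by (auto simp: o_def)
  then have "(\<lambda>k. \<Lambda> (r (s k))) \<longlonglongrightarrow> \<Lambda>'" "(\<lambda>k. \<Psi> (r (s k))) \<longlonglongrightarrow> \<Psi>'"
    by (auto simp: tendsto_Pair_iff)
  moreover have "strict_mono (\<lambda>k. r (s k))"
    using r s by (simp add: strict_mono_def)
  ultimately show ?thesis
    using lim[THEN LIMSEQ_subseq_LIMSEQ[OF _ s], unfolded o_def] by (intro KKT_split_limit)
qed

text \<open>Convergence of \<open>X\<close> and \<open>Y\<close> along a subsequence carries the
  other blocks along: \<open>U\<close> and \<open>V\<close> by the vanishing residuals,
  \<open>Z\<close> as a continuous function of \<open>X\<close> and \<open>Y\<close>.\<close>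

lemma accumulation_point_extend:
  assumes "accumulation_point (\<lambda>k. (X k, Y k)) (X', Y')"
  shows "accumulation_point (\<lambda>k. (X k, Y k, Z k, U k, V k))
           (X', Y', X' ** Y' + proj_on \<Omega> (M - X' ** Y'), X', Y')"
proof -
  obtain r where r: "strict_mono r" and "(\<lambda>k. (X (r k), Y (r k))) \<longlonglongrightarrow> (X', Y')"
    using assms by (auto simp: accumulation_point_def o_def)
  then have lim: "(\<lambda>k. X (r k)) \<longlonglongrightarrow> X'" "(\<lambda>k. Y (r k)) \<longlonglongrightarrow> Y'"
    by (auto simp: tendsto_Pair_iff)
  have "(\<lambda>k. U (r k)) \<longlonglongrightarrow> X'" "(\<lambda>k. V (r k)) \<longlonglongrightarrow> Y'"
    using tendsto_diff[OF lim(1) LIMSEQ_subseq_LIMSEQ[OF residual_tendsto_0(1) r, unfolded o_def]]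
      tendsto_diff[OF lim(2) LIMSEQ_subseq_LIMSEQ[OF residual_tendsto_0(2) r, unfolded o_def]]
    by simp_all
  moreover have "(\<lambda>k. Z (r k)) \<longlonglongrightarrow> X' ** Y' + proj_on \<Omega> (M - X' ** Y')"
  proof (rule Lim_transform_eventually)
    show "(\<lambda>k. X (r k) ** Y (r k) + proj_on \<Omega> (M - X (r k) ** Y (r k)))
        \<longlonglongrightarrow> X' ** Y' + proj_on \<Omega> (M - X' ** Y')"
      by (intro tendsto_intros lim)
    \<comment> \<open>The initial \<open>Z\<close> is arbitrary, so the formula holds from index 1
      on, and \<open>r k\<close> is at least \<open>k\<close>.\<close>
    have "X j ** Y j + proj_on \<Omega> (M - X j ** Y j) = Z j" if "j > 0" for j
      using that by (metis Z_Suc gr0_implies_Suc)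
    moreover have "r k > 0" if "k > 0" for k
      using seq_suble[OF r, of k] that by linarith
    ultimately show "\<forall>\<^sub>F k in sequentially.
        X (r k) ** Y (r k) + proj_on \<Omega> (M - X (r k) ** Y (r k)) = Z (r k)"
      by (intro eventually_mono[OF eventually_gt_at_top[of 0]]) simp
  qed
  ultimately show ?thesis
    unfolding accumulation_point_def o_def using r lim by (auto intro!: exI[of _ r] tendsto_Pair)
qed

end

text \<open>The two conditions on \<open>Z\<close> identify \<open>X ** Y - Z\<close> with
  \<open>proj_on \<Omega> (X ** Y - M)\<close>: it vanishes off \<Omega>, and \<open>Z\<close>
  agrees with \<open>M\<close> on \<Omega>. The gradients of the reduced problem are therefore the
  negated multipliers.\<close>

lemma KKT_nonneg_if_KKT_split:
  assumes "KKT_split \<Omega> M X Y Z U V"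
  shows "KKT_nonneg \<Omega> M X Y"
proof -
  obtain \<Lambda> \<Psi> where kkt: "(X ** Y - Z) ** transpose Y + \<Lambda> = 0" "transpose X ** (X ** Y - Z) + \<Psi> = 0"
    "proj_on (- \<Omega>) (X ** Y - Z) = 0" "proj_on \<Omega> (Z - M) = 0" "X = U" "Y = V"
    "\<Lambda> \<le> 0" "0 \<le> U" "\<Lambda> * U = 0" "\<Psi> \<le> 0" "0 \<le> V" "\<Psi> * V = 0"
    using assms by (auto simp: KKT_split_def)
  have "(X ** Y - Z) $ i $ j = proj_on \<Omega> (X ** Y - M) $ i $ j" for i j
    using arg_cong[OF kkt(3), of "\<lambda>A. A $ i $ j"] arg_cong[OF kkt(4), of "\<lambda>A. A $ i $ j"]
    by (simp add: proj_on_nth split: if_splits)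
  then have "X ** Y - Z = proj_on \<Omega> (X ** Y - M)"
    by (simp add: vec_eq_iff)
  then have "proj_on \<Omega> (X ** Y - M) ** transpose Y = - \<Lambda>" "transpose X ** proj_on \<Omega> (X ** Y - M) = - \<Psi>"
    using kkt(1,2) by (simp_all add: eq_neg_iff_add_eq_0)
  then show ?thesis
    using kkt(5-) by (simp add: KKT_nonneg_def less_eq_vec_def mult.commute)
qed

theorem theorem2p1:
  fixes M :: "real ^ 'n ^ 'm" and \<Omega> :: "('m \<times> 'n) set" and \<alpha> \<beta> \<gamma> :: real
    and X U \<Lambda> :: "nat \<Rightarrow> real ^ 'q ^ 'm"
    and Y V \<Psi> :: "nat \<Rightarrow> real ^ 'n ^ 'q"
    and Z :: "nat \<Rightarrow> real ^ 'n ^ 'm"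
  assumes "\<alpha> > 0" and "\<beta> > 0" and "\<gamma> \<in> {0<..<1.618}"
    and "adm_sequence \<Omega> M \<alpha> \<beta> \<gamma> X Y Z U V \<Lambda> \<Psi>"
    and "bounded (range (\<lambda>k. (\<Lambda> k, \<Psi> k)))"
    and "summable (\<lambda>k. (frob_norm (\<Lambda> (Suc k) - \<Lambda> k))\<^sup>2 + (frob_norm (\<Psi> (Suc k) - \<Psi> k))\<^sup>2)"
  shows "(\<forall>X' Y' Z' U' V'.
            accumulation_point (\<lambda>k. (X k, Y k, Z k, U k, V k)) (X', Y', Z', U', V')
              \<longrightarrow> KKT_split \<Omega> M X' Y' Z' U' V') \<and>
         (\<forall>X' Y'. accumulation_point (\<lambda>k. (X k, Y k)) (X', Y') \<longrightarrow> KKT_nonneg \<Omega> M X' Y')"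
proof -
  interpret adm M \<Omega> \<alpha> \<beta> \<gamma> X U \<Lambda> Y V \<Psi> Z
    using assms by unfold_locales (simp_all add: frob_norm_eq_norm)
  show ?thesis
    using KKT_split_accumulation_point accumulation_point_extend KKT_nonneg_if_KKT_split by blast
qed

end
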